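(* Let $m\geq 1$ and $n\geq 1$ be integers, let $A$ be an invertible real $n\times n$ matrix, let $(B_k)_{k\geq 0}$ be a sequence of real $n\times n$ matrices, and put $D_k:=A^{-k-1}B_kA^{k-m}$ for $k\geq 0$ and $\mathfrak{D}=(D_k)_{k\ge 0}$. With the matrices $P^{\mathfrak{D}}(k,j)$ defined in the context, define $\Phi:\mathbb{Z}\to\mathbb{R}^{n\times n}$ by $$\Phi(k)=\begin{cases}\Theta & \text{if } k\leq -m-1,\\ A^k & \text{if } -m\leq k\leq 0,\\ A^k\Bigl(I+\sum_{j=1}^{l}P^{\mathfrak{D}}(k,j)\Bigr) & \text{if } (l-1)(m+1)+1\leq k\leq l(m+1),\ l\geq 1,\end{cases}$$ where $\Theta$ is the zero matrix and $I$ the identity matrix. Then $\Phi$ solves the matrix initial value problem $$\Phi(k+1)=A\Phi(k)+B_k\Phi(k-m)\quad\text{for all integers }k\geq 0,\qquad \Phi(k)=A^k\quad\text{for } -m\leq k\leq 0.$$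
   Context: No commutativity is assumed between $A$ and the $B_k$, nor among the $D_k$. For $d\geq 1$ and every integer $k\geq (d-1)(m+1)+1$, $$P^{\mathfrak{D}}(k,d):=\sum_{j_1=(d-1)(m+1)}^{k-1}D_{j_1}\sum_{j_2=(d-1)(m+1)}^{j_1}D_{j_2-(m+1)}\cdots\sum_{j_d=(d-1)(m+1)}^{j_{d-1}}D_{j_d-(d-1)(m+1)},$$ i.e. the sum over all integer tuples with $k-1\geq j_1\geq j_2\geq\cdots\geq j_d\geq (d-1)(m+1)$ of the ordered product $D_{j_1}D_{j_2-(m+1)}D_{j_3-2(m+1)}\cdots D_{j_d-(d-1)(m+1)}$. *)

theory Defs
  imports "HOL-Analysis.Analysis"
begin

(* Multiplication, 1 and (^) on the type real^'n^'n act entrywise.  Matrix powers are therefore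
   built from the matrix product ** and the identity matrix mat 1. *)

primrec mat_pow :: "real^'n^'n \<Rightarrow> nat \<Rightarrow> real^'n^'n" where
  "mat_pow A 0 = mat 1"
| "mat_pow A (Suc k) = A ** mat_pow A k"

definition mat_powi :: "real^'n^'n \<Rightarrow> int \<Rightarrow> real^'n^'n" where
  "mat_powi A k = (if 0 \<le> k then mat_pow A (nat k) else mat_pow (matrix_inv A) (nat (- k)))"

definition D_seq :: "real^'n^'n \<Rightarrow> (nat \<Rightarrow> real^'n^'n) \<Rightarrow> nat \<Rightarrow> nat \<Rightarrow> real^'n^'n" where
  "D_seq A B m k = mat_powi A (- int k - 1) ** B k ** mat_powi A (int k - int m)"

(* nested_sum D m a r t u consists of the t innermost sums of P(k, r + t), where r outer sums
   have been stripped, u is the upper bound of the next index and a the common lower bound: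
     sum_{j_{r+1} = a}^{u}          D_{j_{r+1} - r(m+1)}
       sum_{j_{r+2} = a}^{j_{r+1}}  D_{j_{r+2} - (r+1)(m+1)}
         ... (t sums). *)
primrec nested_sum ::
  "(nat \<Rightarrow> real^'n^'n) \<Rightarrow> nat \<Rightarrow> nat \<Rightarrow> nat \<Rightarrow> nat \<Rightarrow> nat \<Rightarrow> real^'n^'n" where
  "nested_sum D m a r 0 u = mat 1"
| "nested_sum D m a r (Suc t) u =
     (\<Sum>j = a..u. D (j - r * (m + 1)) ** nested_sum D m a (Suc r) t j)"

(* Meaningful for d >= 1 and k >= (d-1)(m+1)+1; then none of the subtractions on nat truncates. *)
definition P_mat :: "(nat \<Rightarrow> real^'n^'n) \<Rightarrow> nat \<Rightarrow> nat \<Rightarrow> nat \<Rightarrow> real^'n^'n" where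
  "P_mat D m k d = nested_sum D m ((d - 1) * (m + 1)) 0 d (k - 1)"

lemma P_mat_1: "P_mat D m k 1 = (\<Sum>j = 0..k - 1. D j)"
  by (simp add: P_mat_def)

lemma P_mat_2:
  "P_mat D m k 2 = (\<Sum>j\<^sub>1 = m + 1..k - 1. D j\<^sub>1 ** (\<Sum>j\<^sub>2 = m + 1..j\<^sub>1. D (j\<^sub>2 - (m + 1))))"
  by (simp add: P_mat_def numeral_2_eq_2)

definition in_block :: "nat \<Rightarrow> int \<Rightarrow> nat \<Rightarrow> bool" where
  "in_block m k l \<longleftrightarrow>
     1 \<le> l \<and> (int l - 1) * (int m + 1) + 1 \<le> k \<and> k \<le> int l * (int m + 1)"

lemma in_block_unique:
  assumes "in_block m k l" "in_block m k l'"
  shows "l = l'"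
proof -
  have aux: "a \<le> b" if "in_block m k a" "in_block m k b" for a b
  proof (rule ccontr)
    assume "\<not> a \<le> b"
    then have "int b * (int m + 1) \<le> (int a - 1) * (int m + 1)"
      by (intro mult_right_mono) auto
    with that show False by (simp add: in_block_def)
  qed
  show ?thesis using aux assms by (meson le_antisym)
qed

lemma in_block_exists:
  assumes "1 \<le> k"
  shows "in_block m k (nat ((k - 1) div (int m + 1) + 1))"
proof -
  define q where "q = (k - 1) div (int m + 1)"
  have q: "0 \<le> q" using assms by (simp add: q_def pos_imp_zdiv_nonneg_iff)
  have eq: "k - 1 = q * (int m + 1) + (k - 1) mod (int m + 1)"
    unfolding q_def by (rule div_mult_mod_eq [symmetric])
  have r: "0 \<le> (k - 1) mod (int m + 1)" "(k - 1) mod (int m + 1) < int m + 1"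
    by (rule pos_mod_sign, simp, rule pos_mod_bound, simp)
  have "(q + 1) * (int m + 1) = q * (int m + 1) + (int m + 1)" by (simp add: algebra_simps)
  then have "q * (int m + 1) + 1 \<le> k" "k \<le> (q + 1) * (int m + 1)"
    using eq r by linarith+
  then show ?thesis using q by (simp add: in_block_def q_def [symmetric])
qed

(* The description below is proper for k >= 1, by in_block_exists and in_block_unique. *)
definition Phi :: "real^'n^'n \<Rightarrow> (nat \<Rightarrow> real^'n^'n) \<Rightarrow> nat \<Rightarrow> int \<Rightarrow> real^'n^'n" where
  "Phi A B m k =
     (if k \<le> - int m - 1 then 0
      else if k \<le> 0 then mat_powi A k
      else mat_powi A k **
        (mat 1 + (\<Sum>j = 1..(THE l. in_block m k l). P_mat (D_seq A B m) m (nat k) j)))"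

lemma Phi_pos:
  assumes "in_block m k l"
  shows "Phi A B m k =
    mat_powi A k ** (mat 1 + (\<Sum>j = 1..l. P_mat (D_seq A B m) m (nat k) j))"
proof -
  have "(THE l. in_block m k l) = l"
    using assms in_block_unique by (intro the_equality)
  moreover have "0 < k"
  proof -
    have "0 \<le> (int l - 1) * (int m + 1)" using assms by (simp add: in_block_def)
    then show ?thesis using assms unfolding in_block_def by linarith
  qed
  ultimately show ?thesis by (simp add: Phi_def)
qed

end

(* Write \<Phi>(k) = A^k \<Psi>(k).  Since A^(k+1) D_k = B_k A^(k-m), the claim is equivalent to
   \<Psi>(k+1) = \<Psi>(k) + D_k \<Psi>(k-m).  Splitting off the summand j_1 = k of P(k+1,d+1) and shifting
   all remaining indices by m+1 gives P(k+1,d+1) = P(k,d+1) + D_k P(k-m,d), and summation over d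
   yields the recurrence for \<Psi>.  As P(k,d) is an empty sum for k \<le> (d-1)(m+1), the sum over d
   may be extended beyond the block of k, so that no case distinction at block borders is needed. *)
theory Submission
  imports Defs
begin

lemma mat_pow_Suc_right: "mat_pow A (Suc k) = mat_pow A k ** A"
  by (induction k) (simp, metis mat_pow.simps(2) matrix_mul_assoc)

lemma matrix_mult_matrix_inv:
  assumes "invertible A"
  shows "A ** matrix_inv A = mat 1"
  using assms someI_ex [of "\<lambda>A'. A ** A' = mat 1 \<and> A' ** A = mat 1"]
  by (simp add: invertible_def matrix_inv_def)

text \<open>Peeling \<open>A\<close> off on the right and its inverse off on the left leaves an
  adjacent pair that cancels in the middle.\<close>

lemma mat_pow_mult_inv:
  assumes "invertible A"
  shows "mat_pow A k ** mat_pow (matrix_inv A) k = mat 1"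
proof (induction k)
  case (Suc k)
  have "mat_pow A (Suc k) ** mat_pow (matrix_inv A) (Suc k)
      = mat_pow A k ** (A ** matrix_inv A) ** mat_pow (matrix_inv A) k"
    by (subst mat_pow_Suc_right) (simp add: matrix_mul_assoc)
  then show ?case using Suc by (simp add: matrix_mult_matrix_inv [OF assms])
qed simp

lemma mat_powi_Suc: "mat_powi A (int k + 1) = A ** mat_powi A (int k)"
  by (simp add: mat_powi_def nat_add_distrib)

text \<open>Only the leading factor A^(-k-1) of D_k cancels; the trailing A^(k-m) is untouched, so
  the sign of k - m is irrelevant.\<close>

lemma mat_powi_mult_D_seq:
  assumes "invertible A"
  shows "mat_powi A (int k + 1) ** D_seq A B m k = B k ** mat_powi A (int k - int m)"
proof -
  have "mat_powi A (int k + 1) = mat_pow A (Suc k)"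
    by (simp add: mat_powi_Suc) (simp add: mat_powi_def)
  moreover have "nat (int k + 1) = Suc k" by simp
  then have "mat_powi A (- int k - 1) = mat_pow (matrix_inv A) (Suc k)"
    unfolding mat_powi_def by (simp add: algebra_simps del: mat_pow.simps)
  ultimately show ?thesis
    by (simp add: D_seq_def matrix_mul_assoc mat_pow_mult_inv [OF assms] del: mat_pow.simps)
qed

lemma matrix_sum_distrib_left:
  fixes M :: "real^'n^'n" and f :: "'b \<Rightarrow> real^'n^'n"
  shows "M ** (\<Sum>i\<in>I. f i) = (\<Sum>i\<in>I. M ** f i)"
  by (induction I rule: infinite_finite_induct) (simp_all add: matrix_add_ldistrib)

text \<open>Substitute j + (m+1) for j in every sum: one more stripped sum raises the offset in the
  index of \<open>D\<close> by m+1, which absorbs the shift.\<close>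

lemma nested_sum_shift:
  "nested_sum D m (a + (m + 1)) (Suc r) t (u + (m + 1)) = nested_sum D m a r t u"
proof (induction t arbitrary: r u)
  case (Suc t)
  show ?case
    by (simp only: nested_sum.simps sum.shift_bounds_cl_nat_ivl Suc) simp
qed simp

text \<open>The outermost range ends at k - 1, below its start. For k = 0 the truncated
  \<open>k - 1\<close> would leave \<open>D 0\<close> in P(0,1), hence
  \<open>1 \<le> k\<close>.\<close>

lemma P_mat_eq_0:
  assumes "1 \<le> k" "1 \<le> d" "k \<le> (d - 1) * (m + 1)"
  shows "P_mat D m k d = 0"
proof -
  obtain t where "d = Suc t" using assms(2) by (cases d) auto
  then show ?thesis using assms by (simp add: P_mat_def)
qed

lemma P_mat_Suc_1:
  assumes "1 \<le> k"
  shows "P_mat D m (Suc k) (Suc 0) = P_mat D m k (Suc 0) + D k"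
  using assms by (cases k) (simp_all add: P_mat_def)

lemma P_mat_Suc:
  assumes "m + 1 \<le> k" "1 \<le> d"
  shows "P_mat D m (Suc k) (Suc d) = P_mat D m k (Suc d) + D k ** P_mat D m (k - m) d"
\<comment> \<open>The summand j_1 = k exists only in this case; otherwise all three terms are empty
  sums.\<close>
proof (cases "d * (m + 1) \<le> k")
  case True
  obtain u where k: "k = Suc u" using assms by (cases k) auto
  obtain e where d: "d = Suc e" using assms by (cases d) auto
  have "nested_sum D m (e * (m + 1) + (m + 1)) (Suc 0) d (k - m - 1 + (m + 1))
      = P_mat D m (k - m) d"
    by (subst nested_sum_shift) (simp add: P_mat_def d)
  moreover have "k - m - 1 + (m + 1) = k" using assms by simp
  moreover have "e * (m + 1) + (m + 1) = d * (m + 1)" by (simp add: d)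
  ultimately have shift: "nested_sum D m (d * (m + 1)) (Suc 0) d k = P_mat D m (k - m) d"
    by metis
  have "{d * (m + 1)..k} = insert k {d * (m + 1)..u}" "k \<notin> {d * (m + 1)..u}"
    using True k by auto
  then have "P_mat D m (Suc k) (Suc d)
      = D k ** nested_sum D m (d * (m + 1)) (Suc 0) d k + P_mat D m k (Suc d)"
    by (simp add: P_mat_def k del: mult_Suc mult_Suc_right sum.cl_ivl_Suc)
  then show ?thesis unfolding shift by (simp only: add.commute)
next
  case False
  obtain e where d: "d = Suc e" using assms by (cases d) auto
  have "P_mat D m (Suc k) (Suc d) = 0" "P_mat D m k (Suc d) = 0"
    using False assms by (auto intro!: P_mat_eq_0)
  \<comment> \<open>k \<le> d(m+1) - 1 gives exactly k - m \<le> (d-1)(m+1).\<close>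
  moreover have "P_mat D m (k - m) d = 0"
    using False assms by (intro P_mat_eq_0) (auto simp: d)
  ultimately show ?thesis by simp
qed

lemma Phi_eq_sum:
  assumes "1 \<le> k" "k \<le> N * (m + 1)"
  shows "Phi A B m (int k)
    = mat_powi A (int k) ** (mat 1 + (\<Sum>j = 1..N. P_mat (D_seq A B m) m k j))"
proof -
  obtain l where l: "in_block m (int k) l"
    using in_block_exists [of "int k" m] assms(1) by auto
  have "1 \<le> l" "(int l - 1) * (int m + 1) < int k" "int k \<le> int (l * (m + 1))"
    using l by (auto simp: in_block_def algebra_simps)
  moreover have "(int l - 1) * (int m + 1) = int ((l - 1) * (m + 1))"
    using \<open>1 \<le> l\<close> by (simp only: of_nat_mult of_nat_diff of_nat_add of_nat_1)
  ultimately have "(l - 1) * (m + 1) < k" "k \<le> l * (m + 1)"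
    by linarith+
  \<comment> \<open>The block of k starts below N(m+1), so its number is at most N and the sum up to
    l can only be lengthened.\<close>
  then have "(l - 1) * (m + 1) < N * (m + 1)" using assms(2) by linarith
  then have "l \<le> N" using \<open>1 \<le> l\<close> by (simp only: mult_less_cancel2) linarith
  have "P_mat (D_seq A B m) m k j = 0" if "j \<in> {1..N} - {1..l}" for j
  proof (rule P_mat_eq_0)
    have "l * (m + 1) \<le> (j - 1) * (m + 1)"
      using that by (intro mult_right_mono) auto
    then show "k \<le> (j - 1) * (m + 1)" using \<open>k \<le> l * (m + 1)\<close> by linarith
  qed (use that assms in auto)
  then have "(\<Sum>j = 1..l. P_mat (D_seq A B m) m k j) = (\<Sum>j = 1..N. P_mat (D_seq A B m) m k j)"
    using \<open>l \<le> N\<close> by (intro sum.mono_neutral_left) auto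
  then show ?thesis by (simp add: Phi_pos [OF l])
qed

lemma Phi_nonpos:
  assumes "- int m \<le> k" "k \<le> 0"
  shows "Phi A B m k = mat_powi A k"
  using assms by (simp add: Phi_def)

lemma Phi_Suc:
  assumes "invertible A"
  shows "Phi A B m (int k + 1) = A ** Phi A B m (int k) + B k ** Phi A B m (int k - int m)"
proof -
  define D where "D = D_seq A B m"
  \<comment> \<open>As k \<le> k(m+1), taking k summands always suffices; k = 0 gives the
    identity.\<close>
  define \<Psi> where "\<Psi> k = mat 1 + (\<Sum>j = 1..k. P_mat D m k j)" for k
  have Phi_eq: "Phi A B m (int i) = mat_powi A (int i) ** \<Psi> i" for i
  proof (cases "i = 0")
    case True
    then show ?thesis by (simp add: Phi_nonpos \<Psi>_def)
  next
    case False
    then show ?thesis using Phi_eq_sum [of i i m A B] by (simp add: \<Psi>_def D_def)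
  qed
  \<comment> \<open>\<open>X\<close> stands for \<Psi>(k-m), continued by the identity to arguments
    from -m to 0, where \<Phi> is a plain power.\<close>
  define X where "X = (if k \<le> m then mat 1 else \<Psi> (k - m))"
  have X: "Phi A B m (int k - int m) = mat_powi A (int k - int m) ** X"
  proof (cases "k \<le> m")
    case True
    then show ?thesis by (simp add: X_def Phi_nonpos)
  next
    case False
    then show ?thesis using Phi_eq [of "k - m"] by (simp add: X_def of_nat_diff)
  qed
  have "\<Psi> (Suc k) = \<Psi> k + D k ** X"
  proof (cases "k = 0")
    case True
    then show ?thesis by (simp add: \<Psi>_def X_def P_mat_def)
  next
    case False
    have head: "\<Psi> (Suc k) = mat 1 + (P_mat D m k (Suc 0) + D k)
        + (\<Sum>j = 1..k. P_mat D m (Suc k) (Suc j))"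
      using False
      by (simp add: \<Psi>_def sum.atLeast_Suc_atMost sum.shift_bounds_cl_Suc_ivl P_mat_Suc_1
          add.assoc del: sum.cl_ivl_Suc)
    \<comment> \<open>\<Psi>(k) has one summand fewer than \<Psi>(k+1); a zero term pads it for a
      termwise comparison.\<close>
    have "P_mat D m k (Suc k) = 0" using False by (intro P_mat_eq_0) auto
    then have "\<Psi> k = mat 1 + (\<Sum>j = 1..Suc k. P_mat D m k j)" by (simp add: \<Psi>_def)
    then have old: "\<Psi> k = mat 1 + P_mat D m k (Suc 0) + (\<Sum>j = 1..k. P_mat D m k (Suc j))"
      by (simp add: sum.atLeast_Suc_atMost sum.shift_bounds_cl_Suc_ivl add.assoc
          del: sum.cl_ivl_Suc)
    show ?thesis
    proof (cases "k \<le> m")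
      case True
      \<comment> \<open>Here k + 1 \<le> m + 1 \<le> j(m+1), so only the first-order sums survive
        and they grow by D_k.\<close>
      have "P_mat D m (Suc k) (Suc j) = 0" "P_mat D m k (Suc j) = 0" if "j \<in> {1..k}" for j
      proof -
        have "1 * (m + 1) \<le> j * (m + 1)" using that by (intro mult_right_mono) auto
        then show "P_mat D m (Suc k) (Suc j) = 0" "P_mat D m k (Suc j) = 0"
          using True False by (auto intro!: P_mat_eq_0)
      qed
      then show ?thesis by (simp add: head old X_def True)
    next
      case large: False
      \<comment> \<open>\<Psi>(k-m) is padded in the same way, from k - m to k summands, so that
        \<open>P_mat_Suc\<close> can be summed over j.\<close>
      have "P_mat D m (k - m) j = 0" if "j \<in> {1..k} - {1..k - m}" for j
      proof (rule P_mat_eq_0)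
        have "j - 1 \<le> (j - 1) * (m + 1)" by simp
        moreover have "k - m \<le> j - 1" using that by auto
        ultimately show "k - m \<le> (j - 1) * (m + 1)" by linarith
      qed (use that large in auto)
      then have "(\<Sum>j = 1..k - m. P_mat D m (k - m) j) = (\<Sum>j = 1..k. P_mat D m (k - m) j)"
        by (intro sum.mono_neutral_left) auto
      then have "D k ** X = D k + (\<Sum>j = 1..k. D k ** P_mat D m (k - m) j)"
        using large by (simp add: X_def \<Psi>_def matrix_add_ldistrib matrix_sum_distrib_left)
      moreover have "(\<Sum>j = 1..k. P_mat D m (Suc k) (Suc j))
          = (\<Sum>j = 1..k. P_mat D m k (Suc j)) + (\<Sum>j = 1..k. D k ** P_mat D m (k - m) j)"
        using large by (simp add: P_mat_Suc sum.distrib)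
      ultimately show ?thesis by (simp add: head old)
    qed
  qed
  then have "Phi A B m (int k + 1)
      = mat_powi A (int k + 1) ** \<Psi> k + mat_powi A (int k + 1) ** D k ** X"
    using Phi_eq [of "Suc k"] by (simp add: matrix_add_ldistrib matrix_mul_assoc add.commute)
  also have "mat_powi A (int k + 1) ** D k = B k ** mat_powi A (int k - int m)"
    using mat_powi_mult_D_seq [OF assms] by (simp add: D_def)
  finally show ?thesis
    by (simp add: Phi_eq X mat_powi_Suc matrix_mul_assoc)
qed

theorem theorem3:
  fixes A :: "real^'n^'n" and B :: "nat \<Rightarrow> real^'n^'n" and m :: nat
  assumes "1 \<le> m" and "invertible A"
  shows "(\<forall>k::nat. Phi A B m (int k + 1) =
             A ** Phi A B m (int k) + B k ** Phi A B m (int k - int m)) \<and>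
         (\<forall>k::int. - int m \<le> k \<and> k \<le> 0 \<longrightarrow> Phi A B m k = mat_powi A k)"
  using Phi_Suc [OF assms(2)] Phi_nonpos by blast

end
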